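(* Let $T:\mathbb{R}^n\to\mathbb{R}^n$ be a monotone additively homogeneous map. Assume that for every $g\in\mathbb{R}^n$ the ergodic equation $g+T(u)=\lambda e+u$ has a solution $(\lambda,u)\in\mathbb{R}\times\mathbb{R}^n$. Then the set of vectors $g\in\mathbb{R}^n$ for which the ergodic equation $g+T(u)=\lambda e+u$ fails to have a unique solution up to an additive constant is meager in $\mathbb{R}^n$.
   Context: $\mathbb{R}^n$ carries its coordinatewise partial order, and $e=(1,\dots,1)^\top$. A map $T:\mathbb{R}^n\to\mathbb{R}^n$ is monotone if $x\leq y$ implies $T(x)\leq T(y)$, and additively homogeneous if $T(x+\alpha e)=T(x)+\alpha e$ for all $x\in\mathbb{R}^n$, $\alpha\in\mathbb{R}$. The solution of the equation is unique up to an additive constant if, given a solution $(\lambda,u)$, every solution is of the form $(\lambda,u+\alpha e)$ with $\alpha\in\mathbb{R}$. A set is meager if it is a countable union of nowhere dense sets. *)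

theory Defs
  imports "HOL-Analysis.Analysis"
begin

definition ones_vec :: "real ^ 'n" where
  "ones_vec = (\<chi> i. 1)"

definition additively_homogeneous :: "(real ^ 'n \<Rightarrow> real ^ 'n) \<Rightarrow> bool" where
  "additively_homogeneous T \<longleftrightarrow>
     (\<forall>x \<alpha>. T (x + \<alpha> *\<^sub>R ones_vec) = T x + \<alpha> *\<^sub>R ones_vec)"

definition ergodic_solution ::
  "(real ^ 'n \<Rightarrow> real ^ 'n) \<Rightarrow> real ^ 'n \<Rightarrow> real \<times> (real ^ 'n) \<Rightarrow> bool" where
  "ergodic_solution T g = (\<lambda>(l, u). g + T u = l *\<^sub>R ones_vec + u)"

definition unique_ergodic_solution ::
  "(real ^ 'n \<Rightarrow> real ^ 'n) \<Rightarrow> real ^ 'n \<Rightarrow> bool" where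
  "unique_ergodic_solution T g \<longleftrightarrow>
     (\<exists>s. ergodic_solution T g s) \<and>
     (\<forall>l u. ergodic_solution T g (l, u) \<longrightarrow>
        (\<forall>s. ergodic_solution T g s \<longrightarrow> (\<exists>\<alpha>::real. s = (l, u + \<alpha> *\<^sub>R ones_vec))))"

definition nowhere_dense :: "'a::topological_space set \<Rightarrow> bool" where
  "nowhere_dense S \<longleftrightarrow> interior (closure S) = {}"

(* The sets N k may be empty, so finite unions are included. *)
definition meager :: "'a::topological_space set \<Rightarrow> bool" where
  "meager S \<longleftrightarrow> (\<exists>N :: nat \<Rightarrow> 'a set. (\<forall>k. nowhere_dense (N k)) \<and> S = (\<Union>k. N k))"

end

theory Submission
  imports Defs
begin

text \<open>
  Write the equation as \<open>G (l, u) = g\<close> with \<open>G (l, u) = l e + u - T u\<close>. As \<open>G\<close> is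
  continuous on a \<open>\<sigma>\<close>-compact space, \<open>G\<^sup>-\<^sup>1\<close> is lower semicontinuous at every \<open>g\<close> outside a
  meager set: the exceptional values lie on the frontiers of the images under \<open>G\<close> of countably
  many compact balls. Suppose \<open>G\<^sup>-\<^sup>1\<close> is lower semicontinuous at \<open>g\<close> and that
  \<open>u\<close>, \<open>v\<close> solve the equation for \<open>g\<close> without \<open>u - v\<close> being constant. For small \<open>t > 0\<close> the
  equation for \<open>g + t (v - u)\<close> then has a solution \<open>z\<close> close to \<open>u\<close>, and, up to a constant,
  \<open>T z - T v\<close> is \<open>z - v + t (u - v)\<close>, whose oscillation exceeds that of \<open>z - v\<close>.
  This is impossible, because \<open>T\<close> is nonexpansive for the oscillation \<open>max x - min x\<close>.
\<close>

lemma nowhere_dense_subset: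
  assumes "nowhere_dense B" "A \<subseteq> B"
  shows "nowhere_dense A"
  using assms interior_mono[OF closure_mono[of A B]] unfolding nowhere_dense_def by blast

text \<open>The frontier is closed, and an open set inside it lies in \<open>S\<close>, hence in
  \<open>interior S\<close>, which the frontier avoids.\<close>

lemma nowhere_dense_frontier_closed:
  assumes "closed S"
  shows "nowhere_dense (frontier S)"
proof -
  have "interior (S - interior S) \<subseteq> interior S \<inter> (S - interior S)"
    using interior_subset[of "S - interior S"] interior_mono[of "S - interior S" S] by blast
  then show ?thesis
    using assms by (auto simp: nowhere_dense_def frontier_def closed_Diff)
qed

lemma meager_if_subset_countable_Union:
  assumes "countable C" "\<And>N. N \<in> C \<Longrightarrow> nowhere_dense N" "S \<subseteq> \<Union>C"
  shows "meager S"
proof (cases "C = {}")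
  case True
  then have "S = (\<Union>k::nat. {})" using assms(3) by auto
  moreover have "nowhere_dense ({} :: 'a set)" by (simp add: nowhere_dense_def)
  ultimately show ?thesis unfolding meager_def by (intro exI[of _ "\<lambda>_. {}"]) auto
next
  case False
  then have "\<Union>C = (\<Union>k. from_nat_into C k)"
    using assms(1) by (metis range_from_nat_into)
  \<comment> \<open>\<open>meager\<close> asks for equality with the union, so each member of
    \<open>C\<close> is cut down to \<open>S\<close>.\<close>
  then have "S = (\<Union>k. from_nat_into C k \<inter> S)" using assms(3) by auto
  moreover have "nowhere_dense (from_nat_into C k \<inter> S)" for k
    using assms(2)[OF from_nat_into[OF False]] nowhere_dense_subset by blast
  ultimately show ?thesis unfolding meager_def
    by (intro exI[of _ "\<lambda>k. from_nat_into C k \<inter> S"]) auto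
qed

lemma meager_subset:
  assumes "meager B" "A \<subseteq> B"
  shows "meager A"
proof -
  obtain N where "\<And>k::nat. nowhere_dense (N k)" "B = (\<Union>k. N k)"
    using assms(1) unfolding meager_def by blast
  then show ?thesis
    using assms(2) by (intro meager_if_subset_countable_Union[of "range N"]) auto
qed

text \<open>The image of a closed ball is compact, hence closed, so a value attained on the ball but
  not interior to its image lies on the frontier of that image. Balls with centers in a countable
  dense set and radii \<open>inverse (Suc k)\<close> suffice.\<close>

lemma meager_values_not_locally_interior:
  fixes f :: "'a::{heine_borel,second_countable_topology} \<Rightarrow> 'b::t2_space"
  assumes cont: "continuous_on UNIV f"
  shows "meager {y. \<exists>x. f x = y \<and> (\<exists>e>0. y \<notin> interior (f ` ball x e))}" (is "meager ?S")
proof -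
  obtain D :: "'a set" where D: "countable D" "\<And>X. open X \<Longrightarrow> X \<noteq> {} \<Longrightarrow> \<exists>d\<in>D. d \<in> X"
    using countable_dense_exists by (metis (no_types))
  define K where "K = (\<lambda>(d, k::nat). cball d (inverse (Suc k)) :: 'a set)"
  define C where "C = (\<lambda>p. frontier (f ` K p)) ` (D \<times> UNIV)"
  have closed: "closed (f ` K p)" for p
    unfolding K_def
    by (auto intro!: compact_imp_closed compact_continuous_image continuous_on_subset[OF cont]
        split: prod.split)
  show ?thesis
  proof (rule meager_if_subset_countable_Union)
    show "countable C" unfolding C_def using D(1) by auto
    show "nowhere_dense N" if "N \<in> C" for N
      using that closed nowhere_dense_frontier_closed unfolding C_def by auto
    show "?S \<subseteq> \<Union>C"
    proof
      fix y assume "y \<in> ?S"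
      then obtain x e where xe: "f x = y" "e > 0" "y \<notin> interior (f ` ball x e)" by auto
      \<comment> \<open>Points of \<open>K (d, k)\<close> are within two radii of \<open>x\<close>:
        one from \<open>x\<close> to \<open>d\<close>, one from \<open>d\<close> on.\<close>
      obtain k :: nat where k: "inverse (Suc k) < e / 2"
        using reals_Archimedean[of "e / 2"] xe(2) by auto
      obtain d where d: "d \<in> D" "d \<in> ball x (inverse (Suc k))"
        using D(2)[of "ball x (inverse (Suc k))"] by force
      have "K (d, k) \<subseteq> ball x e"
      proof
        fix z assume "z \<in> K (d, k)"
        then have "dist d z \<le> inverse (Suc k)" by (simp add: K_def)
        then show "z \<in> ball x e" using k d(2) dist_triangle[of x z d] by simp
      qed
      then have "y \<notin> interior (f ` K (d, k))"
        using xe(3) interior_mono[of "f ` K (d, k)" "f ` ball x e"] by blast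
      moreover have "y \<in> f ` K (d, k)"
        using xe(1) d(2) by (auto simp: K_def dist_commute less_imp_le)
      ultimately have "y \<in> frontier (f ` K (d, k))"
        by (simp add: frontier_def closed)
      then show "y \<in> \<Union>C" using d(1) unfolding C_def by blast
    qed
  qed
qed

text \<open>The hypothesis says \<open>x\<close> \<le> \<open>y + c *\<^sub>R ones_vec\<close>;
  monotonicity keeps the inequality and homogeneity pulls \<open>c\<close> out of \<open>T\<close>.
  As \<open>c\<close> may have any sign, using this also with \<open>x\<close> and \<open>y\<close>
  exchanged bounds the maximum and the minimum of \<open>T x - T y\<close>.\<close>

lemma mono_additively_homogeneous_le:
  fixes T :: "real ^ 'n \<Rightarrow> real ^ 'n"
  assumes "mono T" "additively_homogeneous T" "\<And>k. x $ k - y $ k \<le> c"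
  shows "T x $ i - T y $ i \<le> c"
proof -
  have "x $ k \<le> c + y $ k" for k using assms(3)[of k] by linarith
  then have "x \<le> y + c *\<^sub>R ones_vec"
    by (auto simp: less_eq_vec_def ones_vec_def algebra_simps)
  then have "T x \<le> T y + c *\<^sub>R ones_vec"
    using assms(1,2) by (metis monoD additively_homogeneous_def)
  then have "T x $ i \<le> T y $ i + c"
    by (auto simp: less_eq_vec_def ones_vec_def)
  then show ?thesis by simp
qed

lemma mono_additively_homogeneous_continuous_on:
  fixes T :: "real ^ 'n \<Rightarrow> real ^ 'n"
  assumes "mono T" "additively_homogeneous T"
  shows "continuous_on UNIV T"
proof -
  have le: "T x $ i - T y $ i \<le> dist x y" for x y i
  proof (rule mono_additively_homogeneous_le[OF assms])
    show "x $ k - y $ k \<le> dist x y" for k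
      using component_le_norm_cart[of "x - y" k] by (simp add: dist_norm)
  qed
  have "dist (T x $ i) (T y $ i) \<le> 1 * dist x y" for x y i
    using le[of x i y] le[of y i x] by (auto simp: dist_real_def dist_commute abs_le_iff)
  then have "1-lipschitz_on UNIV (\<lambda>x. T x $ i)" for i
    by (intro lipschitz_onI) auto
  then have "continuous_on UNIV (\<lambda>x. \<chi> i. T x $ i)"
    by (intro continuous_on_vec_lambda lipschitz_on_continuous_on)
  then show ?thesis by simp
qed

definition ergodic_map :: "(real ^ 'n \<Rightarrow> real ^ 'n) \<Rightarrow> real \<times> (real ^ 'n) \<Rightarrow> real ^ 'n" where
  "ergodic_map T = (\<lambda>(l, u). l *\<^sub>R ones_vec + u - T u)"

lemma ergodic_solution_iff: "ergodic_solution T g s \<longleftrightarrow> ergodic_map T s = g"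
  by (cases s) (auto simp: ergodic_solution_def ergodic_map_def algebra_simps)

lemma solution_difference_constant:
  fixes T :: "real ^ 'n \<Rightarrow> real ^ 'n"
  assumes T: "mono T" "additively_homogeneous T"
    and u: "ergodic_map T (l, u) = g" and v: "ergodic_map T (m, v) = g"
    and lsc: "\<And>e. e > 0 \<Longrightarrow> g \<in> interior (ergodic_map T ` ball (l, u) e)"
  shows "(u - v) $ p \<le> (u - v) $ q"
proof (rule ccontr)
  assume less: "\<not> (u - v) $ p \<le> (u - v) $ q"
  define d where "d = (u - v) $ p - (u - v) $ q"
  then have d: "d > 0" using less by simp
  \<comment> \<open>The radius is \<open>d / 4\<close> because the final estimate replaces
    \<open>z\<close> by \<open>u\<close> in four coordinates, \<open>i\<close>, \<open>j\<close>,
    \<open>p\<close> and \<open>q\<close>, each at a cost below \<open>d / 4\<close>.\<close>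
  let ?V = "interior (ergodic_map T ` ball (l, u) (d / 4))"
  have "((\<lambda>t. g + t *\<^sub>R (v - u)) \<longlongrightarrow> g + 0 *\<^sub>R (v - u)) (at_right (0::real))"
    by (intro tendsto_intros)
  then have "\<forall>\<^sub>F t in at_right (0::real). g + t *\<^sub>R (v - u) \<in> ?V"
    by (rule topological_tendstoD) (use lsc d in auto)
  then obtain t :: real where t: "t > 0" "g + t *\<^sub>R (v - u) \<in> ?V"
    using eventually_happens[OF eventually_conj[OF _ eventually_at_right_less]]
      trivial_limit_at_right_real by (metis (no_types, lifting))
  then obtain m' z where z: "(m', z) \<in> ball (l, u) (d / 4)"
      "ergodic_map T (m', z) = g + t *\<^sub>R (v - u)"
    using interior_subset by fastforce
  have "dist u z < d / 4"
    using z(1) dist_snd_le[of "(l, u)" "(m', z)"] by simp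
  then have w: "\<bar>z $ k - u $ k\<bar> < d / 4" for k
    using component_le_norm_cart[of "z - u" k] by (simp add: dist_norm norm_minus_commute)
  have eq: "T z $ k - T v $ k = m' - m + (z $ k - v $ k) + t * (u $ k - v $ k)" for k
  proof -
    have "ergodic_map T (m', z) $ k = (ergodic_map T (m, v) + t *\<^sub>R (v - u)) $ k"
      using z(2) v by simp
    then show ?thesis by (simp add: ergodic_map_def ones_vec_def algebra_simps)
  qed
  obtain i where i: "\<And>k. z $ k - v $ k \<le> z $ i - v $ i"
    using Max_in[of "range (\<lambda>k. z $ k - v $ k)"] Max_ge[of "range (\<lambda>k. z $ k - v $ k)"]
    by (metis (mono_tags, lifting) UNIV_not_empty empty_is_image finite finite_imageI imageE rangeI)
  obtain j where j: "\<And>k. z $ j - v $ j \<le> z $ k - v $ k"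
    using Min_in[of "range (\<lambda>k. z $ k - v $ k)"] Min_le[of "range (\<lambda>k. z $ k - v $ k)"]
    by (metis (mono_tags, lifting) UNIV_not_empty empty_is_image finite finite_imageI imageE rangeI)
  \<comment> \<open>Where \<open>z - v\<close> is maximal, \<open>T z - T v\<close> cannot exceed
    it; where it is minimal, \<open>T z - T v\<close> cannot fall below it. Subtracting
    \<open>eq\<close> at \<open>j\<close> from \<open>eq\<close> at \<open>i\<close> cancels
    \<open>m' - m\<close> and leaves only the perturbation.\<close>
  have "T z $ i - T v $ i \<le> z $ i - v $ i"
    using mono_additively_homogeneous_le[OF T i] .
  moreover have "T v $ j - T z $ j \<le> v $ j - z $ j"
    by (rule mono_additively_homogeneous_le[OF T]) (use j in \<open>smt (verit)\<close>)
  ultimately have "t * (u $ i - v $ i) \<le> t * (u $ j - v $ j)"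
    using eq[of i] eq[of j] by linarith
  then have "u $ i - v $ i \<le> u $ j - v $ j" using t(1) by simp
  moreover have "(u $ p - v $ p) - (u $ q - v $ q) = d" by (simp add: d_def)
  ultimately show False
    using i[of p] j[of q] w[of i] w[of j] w[of p] w[of q] by linarith
qed

theorem corollary5p2:
  fixes T :: "real ^ 'n \<Rightarrow> real ^ 'n"
  assumes "mono T"
    and "additively_homogeneous T"
    and "\<forall>g. \<exists>l u. ergodic_solution T g (l, u)"
  shows "meager {g. \<not> unique_ergodic_solution T g}"
proof -
  let ?G = "ergodic_map T"
  let ?S = "{g. \<exists>x. ?G x = g \<and> (\<exists>e>0. g \<notin> interior (?G ` ball x e))}"
  have "continuous_on UNIV (\<lambda>x. T (snd x))"
    by (rule continuous_on_compose2[OF mono_additively_homogeneous_continuous_on[OF assms(1,2)]])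
      (auto intro: continuous_intros)
  then have "continuous_on UNIV ?G"
    unfolding ergodic_map_def case_prod_unfold by (intro continuous_intros)
  then have "meager ?S" by (rule meager_values_not_locally_interior)
  moreover have "unique_ergodic_solution T g" if g: "g \<notin> ?S" for g
    unfolding unique_ergodic_solution_def
  proof (intro conjI allI impI)
    show "\<exists>s. ergodic_solution T g s" using assms(3) by blast
    fix l u s assume lu: "ergodic_solution T g (l, u)" and s: "ergodic_solution T g s"
    obtain m v where s_eq: "s = (m, v)" by (cases s)
    have sol: "?G (l, u) = g" "?G (m, v) = g"
      using lu s by (auto simp: ergodic_solution_iff s_eq)
    have "(u - v) $ p \<le> (u - v) $ q" for p q
      by (rule solution_difference_constant[OF assms(1,2) sol]) (use g sol(1) in blast)
    then have const: "(u - v) $ p = (u - v) $ q" for p q by (simp add: order_antisym)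
    \<comment> \<open>\<open>undefined\<close> serves as an arbitrary coordinate, since
      \<open>u - v\<close> is the same in all of them.\<close>
    define a where "a = (v - u) $ undefined"
    have "v $ k = u $ k + a" for k
      using const[of k undefined] by (simp add: a_def)
    then have v: "v = u + a *\<^sub>R ones_vec" by (simp add: vec_eq_iff ones_vec_def)
    then have "T v = T u + a *\<^sub>R ones_vec"
      using assms(2) by (simp add: additively_homogeneous_def)
    \<comment> \<open>The shift by \<open>a\<close> cancels in \<open>v - T v\<close>, so one
      coordinate already compares \<open>m\<close> with \<open>l\<close>.\<close>
    then have "?G (m, v) $ undefined - ?G (l, u) $ undefined = m - l"
      by (simp add: ergodic_map_def ones_vec_def v)
    then have "m = l" using sol by simp
    then show "\<exists>\<alpha>. s = (l, u + \<alpha> *\<^sub>R ones_vec)" using v s_eq by blast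
  qed
  then have "{g. \<not> unique_ergodic_solution T g} \<subseteq> ?S" by blast
  ultimately show ?thesis by (rule meager_subset)
qed

end
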